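(* Let $k \geq 1$ be an integer. For all graphs $G_1, G_2$, $$\alpha_k(G_1 \boxtimes G_2) \geq \alpha_k(G_1) \cdot \alpha_k(G_2).$$
   Context: Graphs are finite, simple and undirected. For a graph $G$, $\delta_G(u,v)$ is the length of a shortest path between vertices $u$ and $v$ in $G$ (equal to $\infty$ if there is none). A set $S \subseteq V(G)$ is $k$-independent if $\delta_G(u,v) > k$ for all distinct $u,v \in S$; $\alpha_k(G)$ denotes the maximum size of a $k$-independent set in $G$. The strong product $G_1 \boxtimes G_2$ has vertex set $V(G_1)\times V(G_2)$, and two distinct vertices $(u_1,u_2),(v_1,v_2)$ are adjacent if and only if ($u_1=v_1$ or $(u_1,v_1)\in E(G_1)$) and ($u_2=v_2$ or $(u_2,v_2)\in E(G_2)$). *)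

theory Defs
  imports "Graph_Theory.Graph_Theory"
begin

text \<open>
  Finite simple undirected graphs are rendered by the locale \<open>pair_graph\<close>: a finite vertex set
  \<open>pverts\<close> together with a symmetric, irreflexive arc relation \<open>parcs\<close> on it. An edge
  \<open>{u, v}\<close> is the pair of arcs \<open>(u, v)\<close>, \<open>(v, u)\<close>. The null graph is admitted.
\<close>

text \<open>
  The library's shortest-path cost with unit arc weights; it is \<open>\<infinity>\<close> when \<open>v\<close> is not
  reachable from \<open>u\<close>. The library takes the infimum over all walks;
  \<open>graph_dist_eq_INF_apath\<close> below confirms that paths give the same value.
\<close>

definition graph_dist :: "'a pair_pre_digraph \<Rightarrow> 'a \<Rightarrow> 'a \<Rightarrow> ereal" where
  "graph_dist G u v = wf_digraph.\<mu> (with_proj G) (\<lambda>_. 1) u v"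

definition k_independent :: "nat \<Rightarrow> 'a pair_pre_digraph \<Rightarrow> 'a set \<Rightarrow> bool" where
  "k_independent k G S \<longleftrightarrow>
     S \<subseteq> pverts G \<and> (\<forall>u\<in>S. \<forall>v\<in>S. u \<noteq> v \<longrightarrow> graph_dist G u v > ereal (real k))"

definition k_independence_number :: "nat \<Rightarrow> 'a pair_pre_digraph \<Rightarrow> nat" where
  "k_independence_number k G = Max (card ` {S. k_independent k G S})"

definition strong_product ::
    "'a pair_pre_digraph \<Rightarrow> 'b pair_pre_digraph \<Rightarrow> ('a \<times> 'b) pair_pre_digraph" where
  "strong_product G H =
     \<lparr> pverts = pverts G \<times> pverts H,
       parcs = {((u1, u2), (v1, v2)) | u1 u2 v1 v2.
         (u1, u2) \<in> pverts G \<times> pverts H \<and> (v1, v2) \<in> pverts G \<times> pverts H \<and>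
         (u1, u2) \<noteq> (v1, v2) \<and>
         (u1 = v1 \<or> (u1, v1) \<in> parcs G) \<and> (u2 = v2 \<or> (u2, v2) \<in> parcs H)} \<rparr>"

lemma pair_graph_strong_product:
  assumes "pair_graph G" "pair_graph H"
  shows "pair_graph (strong_product G H)"
proof -
  interpret G: pair_graph G by fact
  interpret H: pair_graph H by fact
  have fin: "finite (pverts G \<times> pverts H)" by simp
  have "parcs (strong_product G H) \<subseteq> (pverts G \<times> pverts H) \<times> (pverts G \<times> pverts H)"
    by (auto simp: strong_product_def)
  then have fin': "finite (parcs (strong_product G H))"
    using fin by (meson finite_SigmaI finite_subset)
  have sym: "symmetric (with_proj (strong_product G H))"
    unfolding symmetric_def arcs_ends_conv
    using G.graph_symmetric H.graph_symmetric
    by (auto simp: sym_def strong_product_def arcs_ends_conv image_iff)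
  show ?thesis
    by unfold_locales (use fin fin' sym in \<open>auto simp: strong_product_def\<close>)
qed

lemma graph_dist_eq_INF_apath:
  assumes "pair_graph G"
  shows "graph_dist G u v =
    (INF p\<in>{p. pre_digraph.apath (with_proj G) u p v}. ereal (real (length p)))"
proof -
  interpret pair_graph G by fact
  have cost: "awalk_cost (\<lambda>_. 1) p = real (length p)" for p :: "('a \<times> 'a) list"
    by (induction p) auto
  show ?thesis
    unfolding graph_dist_def \<mu>_def cost
  proof (rule antisym)
    show "(INF p\<in>{p. awalk u p v}. ereal (real (length p))) \<le> (INF p\<in>{p. apath u p v}. ereal (real (length p)))"
      by (rule INF_superset_mono) (auto simp: apath_def)
    show "(INF p\<in>{p. apath u p v}. ereal (real (length p))) \<le> (INF p\<in>{p. awalk u p v}. ereal (real (length p)))"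
    proof (rule INF_greatest)
      fix p assume "p \<in> {p. awalk u p v}"
      then have p: "awalk u p v" by simp
      have "apath u (awalk_to_apath p) v" by (rule apath_awalk_to_apath[OF p])
      moreover have "length (awalk_to_apath p) \<le> length p"
      proof -
        have "\<not> (\<exists>w c. awalk w c w \<and> w \<in> set (pawalk_verts u p) \<and> awalk_cost (\<lambda>_. 1) c < 0)"
          by (simp add: cost)
        from awalk_to_path_no_neg_cyc_cost[OF p this] show ?thesis by (simp add: cost)
      qed
      ultimately show "(INF p\<in>{p. apath u p v}. ereal (real (length p))) \<le> ereal (real (length p))"
        by (intro INF_lower2[of "awalk_to_apath p"]) auto
    qed
  qed
qed

lemma k_independence_number_attained:
  assumes "pair_graph G"
  shows "\<exists>S. k_independent k G S \<and> card S = k_independence_number k G"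
    and "k_independent k G S \<Longrightarrow> card S \<le> k_independence_number k G"
proof -
  interpret pair_graph G by fact
  have "{S. k_independent k G S} \<subseteq> Pow (pverts G)" by (auto simp: k_independent_def)
  then have fin: "finite {S. k_independent k G S}" by (rule finite_subset) simp
  have "k_independent k G {}" by (simp add: k_independent_def)
  then have ne: "card ` {S. k_independent k G S} \<noteq> {}" by blast
  show "\<exists>S. k_independent k G S \<and> card S = k_independence_number k G"
    using Max_in[OF _ ne] fin unfolding k_independence_number_def by force
  show "k_independent k G S \<Longrightarrow> card S \<le> k_independence_number k G"
    unfolding k_independence_number_def using fin by (intro Max_ge) auto
qed

end

theory Submission
  imports Defs
begin

text \<open>
  Each projection of the strong product sends an arc to an arc or to a single vertex, so it does
  not increase distances. Hence a product of \<open>k\<close>-independent sets is \<open>k\<close>-independent.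
\<close>

text \<open>With unit weights the cost of a walk is its length. Walks suit the argument better than
  paths: a projection of a path may revisit vertices, yet it still yields a walk.\<close>

lemma graph_dist_eq_INF_awalk:
  assumes "pair_wf_digraph G"
  shows "graph_dist G u v =
    (INF p\<in>{p. pre_digraph.awalk (with_proj G) u p v}. ereal (real (length p)))"
proof -
  interpret pair_wf_digraph G by fact
  have "awalk_cost (\<lambda>_. 1) p = real (length p)" for p :: "('a \<times> 'a) list"
    by (induction p) auto
  then show ?thesis
    by (simp add: graph_dist_def \<mu>_def)
qed

text \<open>Map the walk arc by arc: an arc whose ends \<open>f\<close> identifies is dropped, any
  other arc becomes an arc of \<open>G\<close>. Dropping arcs is why the length is only bounded, not
  preserved.\<close>

lemma awalk_weak_hom:
  assumes "pair_wf_digraph H" "pair_wf_digraph G"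
    and verts: "\<And>x. x \<in> pverts H \<Longrightarrow> f x \<in> pverts G"
    and arcs: "\<And>x y. (x, y) \<in> parcs H \<Longrightarrow> f x = f y \<or> (f x, f y) \<in> parcs G"
    and "pre_digraph.awalk (with_proj H) u p v"
  shows "\<exists>q. pre_digraph.awalk (with_proj G) (f u) q (f v) \<and> length q \<le> length p"
proof -
  interpret H: pair_wf_digraph H by fact
  interpret G: pair_wf_digraph G by fact
  from \<open>H.awalk u p v\<close> show ?thesis
  proof (induction p arbitrary: u)
    case Nil
    then show ?case
      \<comment> \<open>The empty walk still requires its endpoint to be a vertex, which is where
        \<open>verts\<close> enters.\<close>
      by (auto simp: H.awalk_Nil_iff G.awalk_Nil_iff verts intro!: exI[of _ "[]"])
  next
    case (Cons e p)
    then have e: "e \<in> parcs H" "u = fst e" and "H.awalk (snd e) p v"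
      by (auto simp: H.awalk_Cons_iff)
    then obtain q where q: "G.awalk (f (snd e)) q (f v)" "length q \<le> length p"
      using Cons.IH by blast
    consider "f u = f (snd e)" | "(f u, f (snd e)) \<in> parcs G"
      using arcs[of "fst e" "snd e"] e by auto
    then show ?case
    proof cases
      case 1
      \<comment> \<open>The first arc collapses, so \<open>q\<close> already starts at
        \<open>f u\<close>.\<close>
      with q show ?thesis by (auto intro!: exI[of _ q])
    next
      case 2
      with q show ?thesis
        by (auto simp: G.awalk_Cons_iff intro!: exI[of _ "(f u, f (snd e)) # q"])
    qed
  qed
qed

text \<open>Every walk in the right-hand infimum is matched by one at most as long in the left-hand
  infimum. If \<open>H\<close> has no walk from \<open>u\<close> to \<open>v\<close>, the right side
  is \<infinity>, so unreachable pairs and non-vertices need no separate case.\<close>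

lemma graph_dist_weak_hom_le:
  assumes "pair_wf_digraph H" "pair_wf_digraph G"
    and "\<And>x. x \<in> pverts H \<Longrightarrow> f x \<in> pverts G"
    and "\<And>x y. (x, y) \<in> parcs H \<Longrightarrow> f x = f y \<or> (f x, f y) \<in> parcs G"
  shows "graph_dist G (f u) (f v) \<le> graph_dist H u v"
  unfolding graph_dist_eq_INF_awalk[OF assms(1)] graph_dist_eq_INF_awalk[OF assms(2)]
proof (rule INF_mono)
  fix p assume "p \<in> {p. pre_digraph.awalk (with_proj H) u p v}"
  with awalk_weak_hom[OF assms, where u = u and p = p and v = v]
  show "\<exists>q\<in>{q. pre_digraph.awalk (with_proj G) (f u) q (f v)}.
      ereal (real (length q)) \<le> ereal (real (length p))"
    by auto
qed

lemma graph_dist_strong_product_ge: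
  assumes "pair_graph G" "pair_graph H"
  shows "graph_dist G (fst x) (fst y) \<le> graph_dist (strong_product G H) x y"
    and "graph_dist H (snd x) (snd y) \<le> graph_dist (strong_product G H) x y"
proof -
  interpret G: pair_graph G by fact
  interpret H: pair_graph H by fact
  interpret P: pair_graph "strong_product G H"
    using assms by (rule pair_graph_strong_product)
  show "graph_dist G (fst x) (fst y) \<le> graph_dist (strong_product G H) x y"
    by (rule graph_dist_weak_hom_le[OF P.pair_wf_digraph_axioms G.pair_wf_digraph_axioms])
      (auto simp: strong_product_def)
  show "graph_dist H (snd x) (snd y) \<le> graph_dist (strong_product G H) x y"
    by (rule graph_dist_weak_hom_le[OF P.pair_wf_digraph_axioms H.pair_wf_digraph_axioms])
      (auto simp: strong_product_def)
qed

lemma k_independent_strong_product: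
  assumes "pair_graph G" "pair_graph H" "k_independent k G S" "k_independent k H T"
  shows "k_independent k (strong_product G H) (S \<times> T)"
  unfolding k_independent_def
proof (intro conjI ballI impI)
  show "S \<times> T \<subseteq> pverts (strong_product G H)"
    using assms(3,4) by (auto simp: k_independent_def strong_product_def)
next
  fix x y assume "x \<in> S \<times> T" "y \<in> S \<times> T" "x \<noteq> y"
  \<comment> \<open>Distinct pairs may agree in one coordinate; a coordinate where they differ
    suffices, since the distance there already exceeds \<open>k\<close>.\<close>
  then have "fst x \<in> S" "fst y \<in> S" "snd x \<in> T" "snd y \<in> T" "fst x \<noteq> fst y \<or> snd x \<noteq> snd y"
    by (auto simp: prod_eq_iff)
  then have "ereal (real k) < graph_dist G (fst x) (fst y) \<or>
      ereal (real k) < graph_dist H (snd x) (snd y)"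
    using assms(3,4) unfolding k_independent_def by blast
  then show "ereal (real k) < graph_dist (strong_product G H) x y"
    using graph_dist_strong_product_ge[OF assms(1,2), of x y] less_le_trans by blast
qed

theorem theorem2p4:
  fixes G1 :: "'a pair_pre_digraph" and G2 :: "'b pair_pre_digraph" and k :: nat
  assumes "k \<ge> 1"
    and "pair_graph G1"
    and "pair_graph G2"
  shows "k_independence_number k (strong_product G1 G2)
    \<ge> k_independence_number k G1 * k_independence_number k G2"
proof -
  obtain S where S: "k_independent k G1 S" "card S = k_independence_number k G1"
    using k_independence_number_attained(1)[OF assms(2)] by blast
  obtain T where T: "k_independent k G2 T" "card T = k_independence_number k G2"
    using k_independence_number_attained(1)[OF assms(3)] by blast
  \<comment> \<open>The product of two maximum sets is one candidate in the maximum for the strong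
    product.\<close>
  have "card (S \<times> T) \<le> k_independence_number k (strong_product G1 G2)"
    using k_independence_number_attained(2)[OF pair_graph_strong_product[OF assms(2,3)]]
      k_independent_strong_product[OF assms(2,3) S(1) T(1)] .
  then show ?thesis
    by (simp add: card_cartesian_product S(2) T(2))
qed

end
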